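(* Let $s$ be a nonnegative integer and let $x\in\mathbb{R}^n$. Assume that $B\subset\mathbb{R}^n$ is a nonempty closed convex set invariant under $\mathbf{P}_2$. Then the projection of $x$ onto $C_s\cap B$ can be computed as $$\mathcal{P}_{C_s\cap B}(x)=Q^{-1}\,C_{\mathbf{P}_2}(Qx)\,\mathcal{P}_{\mathcal{C}\cap C_s\cap B}(Qx),$$ where $Q\in\mathbf{P}_2$ is such that $Qx=|x|^{\downarrow}$, and $C_{\mathbf{P}_2}(Qx)$ is the stabiliser of $Qx$ in $\mathbf{P}_2$.
   Context: $\mathbf{P}_2$ is the group of linear maps of $\mathbb{R}^n$ generated by all coordinate permutations and all sign changes of coordinates (signed permutations). Its fundamental chamber is $\mathcal{C}=\{x\in\mathbb{R}^n: x_1\ge x_2\ge\dots\ge x_n\ge 0\}$. $|x|^{\downarrow}$ is the vector of absolute values $|x_i|$ rearranged in nonincreasing order. $B$ is invariant under $\mathbf{P}_2$ if $gB=B$ for all $g\in\mathbf{P}_2$. $C_s=\{x\in\mathbb{R}^n:\|x\|_0\le s\}$, where $\|x\|_0$ is the number of nonzero components of $x$. The stabiliser is $C_{\mathbf{P}_2}(z)=\{h\in\mathbf{P}_2: hz=z\}$. For a set $S$, $\mathcal{P}_S(x)=\{y\in S:\|x-y\|_2=\min_{z\in S}\|x-z\|_2\}$ is the set-valued Euclidean projection. For $H\subset\mathbf{P}_2$ and a set $T\subset\mathbb{R}^n$, $Q^{-1}HT=\{Q^{-1}ht: h\in H,\ t\in T\}$. *)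

theory Defs
  imports "HOL-Analysis.Analysis" "HOL-Combinatorics.Permutations"
    "HOL-Algebra.Bij" "HOL-Algebra.Generated_Groups"
begin

text \<open>The coordinates of \<open>\<real>\<^sup>n\<close> are indexed by a finite linearly ordered type \<open>'n\<close> with
  \<open>n = CARD('n)\<close>; its order plays the role of the order of the indices \<open>1 < \<dots> < n\<close>.\<close>

definition coord_permutations :: "(real^'n \<Rightarrow> real^'n) set" where
  "coord_permutations = {(\<lambda>x. \<chi> i. x $ p i) |p. p permutes UNIV}"

definition sign_changes :: "(real^'n \<Rightarrow> real^'n) set" where
  "sign_changes = {(\<lambda>x. \<chi> i. e i * x $ i) |e. \<forall>i. e i \<in> {1, -1}}"

text \<open>All generators are linear, so generating inside the group of all bijections of \<open>\<real>\<^sup>n\<close>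
  gives the same group as generating inside the general linear group.\<close>

definition P2 :: "(real^'n \<Rightarrow> real^'n) set" where
  "P2 = generate (BijGroup UNIV) (coord_permutations \<union> sign_changes)"

definition P2_stabiliser :: "real^'n \<Rightarrow> (real^'n \<Rightarrow> real^'n) set" where
  "P2_stabiliser z = {h \<in> P2. h z = z}"

definition P2_invariant :: "(real^'n) set \<Rightarrow> bool" where
  "P2_invariant B \<longleftrightarrow> (\<forall>g\<in>P2. g ` B = B)"

definition fundamental_chamber :: "(real^'n::{finite,linorder}) set" where
  "fundamental_chamber = {x. (\<forall>i j. i \<le> j \<longrightarrow> x $ j \<le> x $ i) \<and> (\<forall>i. 0 \<le> x $ i)}"

definition sparse_vectors :: "nat \<Rightarrow> (real^'n) set" where
  "sparse_vectors s = {x. card {i. x $ i \<noteq> 0} \<le> s}"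

text \<open>The entry at index \<open>i\<close> is found at position \<open>card {j. j < i}\<close> (counting from 0) of the
  list of all absolute values, with repetitions, in nonincreasing order.\<close>

definition abs_decreasing :: "real^'n::{finite,linorder} \<Rightarrow> real^'n::{finite,linorder}" where
  "abs_decreasing x =
    (\<chi> i. rev (sorted_list_of_multiset (image_mset (\<lambda>j. \<bar>x $ j\<bar>) (mset_set UNIV))) ! card {j. j < i})"

definition projection :: "(real^'n) set \<Rightarrow> real^'n \<Rightarrow> (real^'n) set" where
  "projection S x = {y. is_arg_min (\<lambda>z. norm (x - z)) (\<lambda>z. z \<in> S) y}"

end

theory Submission
  imports Defs
begin

text \<open>Let \<open>w\<close> be in the fundamental chamber and let \<open>z\<close> maximise the inner product with \<open>w\<close> within its
  orbit. Pick \<open>h\<close> in the stabiliser of \<open>w\<close> such that \<open>h z\<close> has the largest inner product with a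
  fixed interior point \<open>\<rho>\<close> of the chamber. If \<open>h z\<close> violated a wall inequality of the chamber, the
  reflection in that wall would increase \<open>w \<bullet> h z\<close> unless it fixed \<open>w\<close>, and would then increase
  \<open>\<rho> \<bullet> h z\<close>; so \<open>h z\<close> lies in the chamber. Since group elements are isometries, a nearest point to
  \<open>w\<close> in an invariant set is such a maximiser in its orbit.\<close>

text \<open>Frees \<open>inv\<close> for the inverse of a function; the inverse in a group is
  written \<open>m_inv\<close> below.\<close>

unbundle no m_inv_syntax

section \<open>Signed permutations as a normal form for \<open>P2\<close>\<close>

definition signed_perm :: "('n \<Rightarrow> real) \<Rightarrow> ('n \<Rightarrow> 'n) \<Rightarrow> real^'n \<Rightarrow> real^'n" where
  "signed_perm e p x = (\<chi> i. e i * x $ p i)"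

lemma signed_perm_nth [simp]: "signed_perm e p x $ i = e i * x $ p i"
  by (simp add: signed_perm_def)

text \<open>Permutations act by precomposition on indices, hence they compose in reverse
  order.\<close>

lemma signed_perm_comp:
  "signed_perm e p \<circ> signed_perm f q = signed_perm (\<lambda>i. e i * f (p i)) (q \<circ> p)"
  by (simp add: fun_eq_iff vec_eq_iff)

lemma signed_perm_inverse:
  assumes "\<forall>i. e i \<in> {1, -1}" and "p permutes UNIV"
  shows "signed_perm e p \<circ> signed_perm (e \<circ> inv p) (inv p) = id"
    and "signed_perm (e \<circ> inv p) (inv p) \<circ> signed_perm e p = id"
proof -
  have "e i * e i = 1" for i using assms(1)[rule_format, of i] by auto
  then have "e i * (e i * c) = c" for i c by (metis mult.assoc mult_1)
  then show "signed_perm e p \<circ> signed_perm (e \<circ> inv p) (inv p) = id"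
    and "signed_perm (e \<circ> inv p) (inv p) \<circ> signed_perm e p = id"
    using permutes_inverses[OF assms(2)] by (simp_all add: fun_eq_iff vec_eq_iff)
qed

lemma inv_signed_perm:
  assumes "\<forall>i. e i \<in> {1, -1}" and "p permutes UNIV"
  shows "inv (signed_perm e p) = signed_perm (e \<circ> inv p) (inv p)"
  using signed_perm_inverse[OF assms] by (rule inv_unique_comp)

lemma bij_signed_perm:
  assumes "\<forall>i. e i \<in> {1, -1}" and "p permutes UNIV"
  shows "bij (signed_perm e p)"
  using signed_perm_inverse[OF assms] by (intro o_bij)

text \<open>Signed permutations contain the generators and are closed under products and inverses;
  conversely each is a product of two generators. This normal form replaces induction over
  \<open>generate\<close> from here on.\<close>

lemma P2_eq_signed_perms:
  "P2 = {signed_perm e p |e p. (\<forall>i. e i \<in> {1, -1}) \<and> p permutes (UNIV :: 'n::finite set)}"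
  (is "_ = ?S")
proof
  let ?G = "BijGroup (UNIV :: (real^'n) set)"
  have perm: "coord_permutations = {signed_perm (\<lambda>_. 1) p |p. p permutes (UNIV :: 'n set)}"
    and sign: "sign_changes = {signed_perm e id |e. \<forall>i::'n. e i \<in> {1, -1}}"
    unfolding coord_permutations_def sign_changes_def signed_perm_def by auto
  \<comment> \<open>Extensionality, part of the notion \<open>Bij\<close>, is vacuous on
    \<open>UNIV\<close>, so the group product is plain composition.\<close>
  have Bij: "Bij UNIV = {f :: real^'n \<Rightarrow> real^'n. bij f}"
    by (auto simp: Bij_def)
  have mult: "f \<otimes>\<^bsub>?G\<^esub> g = f \<circ> g" if "bij f" "bij g" for f g
    using that by (simp add: BijGroup_def Bij compose_def fun_eq_iff)
  have gens: "coord_permutations \<union> sign_changes \<subseteq> ?S"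
    unfolding perm sign by (auto intro: permutes_id)
  have S_bij: "bij f" if "f \<in> ?S" for f
    using that bij_signed_perm by blast
  show "P2 \<subseteq> ?S"
  proof
    fix f :: "real^'n \<Rightarrow> real^'n"
    assume "f \<in> P2"
    then have "f \<in> generate ?G (coord_permutations \<union> sign_changes)"
      by (simp add: P2_def)
    then show "f \<in> ?S"
    proof (induction rule: generate.induct)
      case one
      have "\<one>\<^bsub>?G\<^esub> = signed_perm (\<lambda>_. 1) id"
        by (auto simp: BijGroup_def fun_eq_iff vec_eq_iff)
      then show ?case by (auto intro: permutes_id)
    next
      case (incl f)
      then show ?case using gens by blast
    next
      case (inv f)
      then obtain e p where f: "f = signed_perm e p" "\<forall>i. e i \<in> {1, -1}" "p permutes (UNIV :: 'n set)"
        using gens by blast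
      have "m_inv ?G f = signed_perm (e \<circ> inv p) (inv p)"
        using inv_BijGroup[of f UNIV] bij_signed_perm[OF f(2,3)] inv_signed_perm[OF f(2,3)]
        by (simp add: f(1) Bij restrict_def)
      then show ?case using f(2) permutes_inv[OF f(3)] by (auto simp: o_def)
    next
      case (eng f g)
      then obtain e p e' p' where fg: "f = signed_perm e p" "\<forall>i. e i \<in> {1, -1}"
        "p permutes (UNIV :: 'n set)" "g = signed_perm e' p'" "\<forall>i. e' i \<in> {1, -1}"
        "p' permutes (UNIV :: 'n set)" by blast
      have "f \<otimes>\<^bsub>?G\<^esub> g = signed_perm (\<lambda>i. e i * e' (p i)) (p' \<circ> p)"
        using fg mult[OF S_bij[OF eng.IH(1)] S_bij[OF eng.IH(2)]] by (simp add: signed_perm_comp)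
      moreover have "\<forall>i. e i * e' (p i) \<in> {1, -1}"
      proof
        fix i
        show "e i * e' (p i) \<in> {1, -1}"
          using fg(2)[rule_format, of i] fg(5)[rule_format, of "p i"] by auto
      qed
      ultimately show ?case using permutes_compose[OF fg(3,6)] by blast
    qed
  qed
  show "?S \<subseteq> P2"
  proof clarify
    fix e :: "'n \<Rightarrow> real" and p :: "'n \<Rightarrow> 'n"
    assume e: "\<forall>i. e i \<in> {1, -1}" and p: "p permutes UNIV"
    \<comment> \<open>The factorisation permutes first and changes signs last, so \<open>e\<close>
      appears unpermuted.\<close>
    let ?e = "signed_perm e id" and ?p = "signed_perm (\<lambda>_. 1) p"
    have mem: "?e \<in> sign_changes" "?p \<in> coord_permutations"
      unfolding perm sign using e p by blast+
    then have "bij ?e" "bij ?p" using gens S_bij by blast+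
    then have "?e \<otimes>\<^bsub>?G\<^esub> ?p = signed_perm e p"
      by (simp add: mult signed_perm_comp)
    moreover have "?e \<otimes>\<^bsub>?G\<^esub> ?p \<in> P2"
      unfolding P2_def using mem by (intro generate.eng generate.incl) auto
    ultimately show "signed_perm e p \<in> P2" by simp
  qed
qed

section \<open>Group structure, finiteness and isometric action of \<open>P2\<close>\<close>

lemma P2_cases:
  assumes "g \<in> P2"
  obtains e p where "g = signed_perm e p" "\<forall>i. e i \<in> {1, -1}" "p permutes UNIV"
  using assms unfolding P2_eq_signed_perms by blast

lemma P2_signed_perm:
  "\<forall>i. e i \<in> {1, -1} \<Longrightarrow> p permutes UNIV \<Longrightarrow> signed_perm e p \<in> P2"
  unfolding P2_eq_signed_perms by blast

lemma P2_id: "id \<in> P2"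
proof -
  have "signed_perm (\<lambda>_. 1) id = id" by (simp add: fun_eq_iff vec_eq_iff)
  then show ?thesis by (metis P2_signed_perm insertI1 permutes_id)
qed

lemma P2_comp:
  assumes "f \<in> P2" "g \<in> P2"
  shows "f \<circ> g \<in> P2"
proof -
  obtain e p where f: "f = signed_perm e p" "\<forall>i. e i \<in> {1, -1}" "p permutes UNIV"
    using assms(1) by (rule P2_cases)
  obtain e' p' where g: "g = signed_perm e' p'" "\<forall>i. e' i \<in> {1, -1}" "p' permutes UNIV"
    using assms(2) by (rule P2_cases)
  have "e i * e' (p i) \<in> {1, -1}" for i
    using f(2)[rule_format, of i] g(2)[rule_format, of "p i"] by auto
  then show ?thesis
    unfolding f(1) g(1) signed_perm_comp
    using permutes_compose[OF f(3) g(3)] by (intro P2_signed_perm) auto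
qed

lemma P2_bij: "g \<in> P2 \<Longrightarrow> bij g"
  using P2_cases bij_signed_perm by metis

lemma P2_inv: "g \<in> P2 \<Longrightarrow> inv g \<in> P2"
  by (erule P2_cases) (simp add: inv_signed_perm P2_signed_perm permutes_inv)

text \<open>Finiteness lets inner products attain their maxima over the group and over
  stabilisers.\<close>

lemma finite_P2: "finite (P2 :: (real^'n::finite \<Rightarrow> real^'n) set)"
proof (rule finite_subset)
  let ?E = "PiE (UNIV :: 'n set) (\<lambda>_. {1, -1 :: real})"
  show "P2 \<subseteq> (\<lambda>(e, p). signed_perm e p) ` (?E \<times> {p. p permutes (UNIV :: 'n set)})"
    unfolding P2_eq_signed_perms by (force simp: PiE_UNIV_domain)
  show "finite ((\<lambda>(e, p). signed_perm e p) ` (?E \<times> {p. p permutes (UNIV :: 'n set)}))"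
    by (intro finite_imageI finite_cartesian_product finite_PiE finite_permutations) auto
qed

lemma P2_inner:
  assumes "g \<in> P2"
  shows "g x \<bullet> g y = x \<bullet> y"
  using assms
proof (rule P2_cases)
  fix e p
  assume g: "g = signed_perm e p" "\<forall>i. e i \<in> {1, -1}" "p permutes UNIV"
  have "(\<Sum>i\<in>UNIV. (e i * x $ p i) * (e i * y $ p i)) = (\<Sum>i\<in>UNIV. x $ p i * y $ p i)"
  proof (rule sum.cong)
    fix i
    show "(e i * x $ p i) * (e i * y $ p i) = x $ p i * y $ p i"
      using g(2)[rule_format, of i] by auto
  qed simp
  also have "\<dots> = (\<Sum>i\<in>UNIV. x $ i * y $ i)"
    using sum.permute[OF g(3), of "\<lambda>i. x $ i * y $ i"] by (simp add: o_def)
  finally show ?thesis by (simp add: g(1) inner_vec_def)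
qed

lemma P2_norm_diff:
  assumes "g \<in> P2"
  shows "norm (g x - g y) = norm (x - y)"
  by (simp add: norm_eq_sqrt_inner inner_diff_left inner_diff_right P2_inner[OF assms])

text \<open>As \<open>g z\<close> and \<open>z\<close> have equal norms, expanding the squares
  leaves only the cross terms.\<close>

lemma norm_diff_P2_le_iff:
  assumes "g \<in> P2"
  shows "norm (w - g z) \<le> norm (w - z) \<longleftrightarrow> w \<bullet> z \<le> w \<bullet> g z"
  by (simp add: norm_le inner_diff_left inner_diff_right P2_inner[OF assms] inner_commute)

lemma P2_sparse:
  assumes "g \<in> P2" "x \<in> sparse_vectors s"
  shows "g x \<in> sparse_vectors s"
  using assms(1)
proof (rule P2_cases)
  fix e p
  assume g: "g = signed_perm e p" "\<forall>i. e i \<in> {1, -1}" "p permutes UNIV"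
  have "e i \<noteq> 0" for i using g(2)[rule_format, of i] by auto
  then have "{i. g x $ i \<noteq> 0} = p -` {i. x $ i \<noteq> 0}" by (auto simp: g(1))
  moreover have "card (p -` {i. x $ i \<noteq> 0}) = card {i. x $ i \<noteq> 0}"
    using permutes_bij[OF g(3)] by (intro card_vimage_inj) (auto simp: bij_def)
  ultimately show ?thesis using assms(2) by (simp add: sparse_vectors_def)
qed

section \<open>Wall reflections and moving points into the chamber\<close>

lemma inner_swap:
  fixes w u :: "real^'n::finite"
  assumes "i \<noteq> j"
  shows "w \<bullet> signed_perm (\<lambda>_. 1) (Transposition.transpose i j) u = w \<bullet> u + (w $ i - w $ j) * (u $ j - u $ i)"
proof -
  \<comment> \<open>The swap is the reflection along \<open>axis i 1 - axis j 1\<close>, which makes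
    the change of the inner product a product of two differences.\<close>
  have "signed_perm (\<lambda>_. 1) (Transposition.transpose i j) u = u + (u $ j - u $ i) *\<^sub>R (axis i 1 - axis j 1)"
    using assms by (auto simp: vec_eq_iff axis_def Transposition.transpose_def)
  then show ?thesis by (simp only: inner_add_right inner_diff_right inner_scaleR_right inner_axis)
    (simp add: algebra_simps)
qed

lemma inner_flip:
  fixes w u :: "real^'n::finite"
  shows "w \<bullet> signed_perm (\<lambda>k. if k = i then -1 else 1) id u = w \<bullet> u - 2 * (w $ i * u $ i)"
proof -
  have "signed_perm (\<lambda>k. if k = i then -1 else 1) id u = u - (2 * u $ i) *\<^sub>R axis i 1"
    by (auto simp: vec_eq_iff axis_def)
  then show ?thesis by (simp only: inner_diff_right inner_scaleR_right inner_axis) simp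
qed

text \<open>Stated for orbit maximisers so that it serves both for constructing chamber
  representatives and for analysing nearest points.\<close>

lemma stabiliser_to_chamber:
  fixes w z :: "real^'n::{finite,linorder}"
  assumes w: "w \<in> fundamental_chamber"
    and max: "\<And>k. k \<in> P2 \<Longrightarrow> w \<bullet> k z \<le> w \<bullet> z"
  shows "\<exists>h\<in>P2_stabiliser w. h z \<in> fundamental_chamber"
proof -
  \<comment> \<open>This is the vector (n, ..., 1): strictly decreasing and positive, hence fixed by
    no wall reflection.\<close>
  define \<rho> :: "(real, 'n) vec" where "\<rho> = (\<chi> i. real (card {j. i \<le> j}))"
  have \<rho>_pos: "\<rho> $ i > 0" for i
    by (auto simp: \<rho>_def card_gt_0_iff)
  have \<rho>_less: "\<rho> $ j < \<rho> $ i" if "i < j" for i j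
  proof -
    have "{k. j \<le> k} \<subset> {k. i \<le> k}"
      using that by (intro psubsetI) (auto simp: set_eq_iff intro!: exI[of _ i])
    then show ?thesis by (simp add: \<rho>_def psubset_card_mono)
  qed
  have "finite (P2_stabiliser w)" "id \<in> P2_stabiliser w"
    using finite_P2 by (auto simp: P2_stabiliser_def P2_id)
  then obtain h where h: "h \<in> P2_stabiliser w"
    and hmax: "\<And>k. k \<in> P2_stabiliser w \<Longrightarrow> \<rho> \<bullet> k z \<le> \<rho> \<bullet> h z"
    using ex_is_arg_min_if_finite[of "P2_stabiliser w" "\<lambda>k. - (\<rho> \<bullet> k z)"]
    by (auto simp: is_arg_min_linorder)
  have hP: "h \<in> P2" and hw: "h w = w" using h by (auto simp: P2_stabiliser_def)
  \<comment> \<open>Since \<open>h\<close> is an isometry fixing \<open>w\<close>, the maximality of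
    \<open>z\<close> passes to \<open>h z\<close>.\<close>
  have "w \<bullet> h z = w \<bullet> z" using P2_inner[OF hP, of w z] hw by simp
  then have wmax: "w \<bullet> k (h z) \<le> w \<bullet> h z" if "k \<in> P2" for k
    using max[OF P2_comp[OF that hP]] by simp
  have \<rho>max: "\<rho> \<bullet> k (h z) \<le> \<rho> \<bullet> h z" if "k \<in> P2" "k w = w" for k
    using hmax[of "k \<circ> h"] P2_comp[OF that(1) hP] that(2) hw by (simp add: P2_stabiliser_def)
  have "h z $ j \<le> h z $ i" if "i < j" for i j
  proof (rule ccontr)
    assume "\<not> ?thesis"
    then have viol: "h z $ j - h z $ i > 0" by simp
    let ?k = "signed_perm (\<lambda>_. 1) (Transposition.transpose i j) :: (real, 'n) vec \<Rightarrow> (real, 'n) vec"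
    have k: "?k \<in> P2" by (intro P2_signed_perm) (auto intro: permutes_swap_id)
    have "(w $ i - w $ j) * (h z $ j - h z $ i) \<le> 0"
      using wmax[OF k] inner_swap[of i j] that by simp
    \<comment> \<open>The chamber gives the converse inequality, so \<open>w\<close> lies on the
      wall and the swap stabilises it; only then may the choice of \<open>h\<close> be used.\<close>
    then have "w $ i \<le> w $ j" using viol by (simp add: mult_le_0_iff)
    moreover have "w $ j \<le> w $ i" using w that by (simp add: fundamental_chamber_def)
    ultimately have "?k w = w" by (auto simp: vec_eq_iff Transposition.transpose_def)
    then have "(\<rho> $ i - \<rho> $ j) * (h z $ j - h z $ i) \<le> 0"
      using \<rho>max[OF k] inner_swap[of i j] that by simp
    then show False using viol \<rho>_less[OF that] by (simp add: mult_le_0_iff)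
  qed
  moreover have "0 \<le> h z $ i" for i
  proof (rule ccontr)
    assume "\<not> ?thesis"
    then have viol: "h z $ i < 0" by simp
    let ?k = "signed_perm (\<lambda>k. if k = i then -1 else 1) id :: (real, 'n) vec \<Rightarrow> (real, 'n) vec"
    have k: "?k \<in> P2" by (intro P2_signed_perm) (auto intro: permutes_id)
    have "w $ i * h z $ i \<ge> 0"
      using wmax[OF k] inner_flip[of w i "h z"] by simp
    then have "w $ i \<le> 0" using viol by (simp add: zero_le_mult_iff)
    moreover have "0 \<le> w $ i" using w by (simp add: fundamental_chamber_def)
    ultimately have "?k w = w" by (auto simp: vec_eq_iff)
    then have "\<rho> $ i * h z $ i \<ge> 0"
      using \<rho>max[OF k] inner_flip[of \<rho> i "h z"] by simp
    then show False using viol \<rho>_pos[of i] by (simp add: zero_le_mult_iff)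
  qed
  ultimately have "h z \<in> fundamental_chamber"
    by (auto simp: fundamental_chamber_def le_less)
  then show ?thesis using h by blast
qed

text \<open>An orbit maximiser \<open>g z\<close> is moved into the chamber by an element fixing
  \<open>w\<close>, which keeps its inner product with \<open>w\<close>. Restricting an invariant
  set to the chamber therefore does not increase the minimal distance.\<close>

lemma P2_to_chamber_closer:
  fixes w z :: "real^'n::{finite,linorder}"
  assumes w: "w \<in> fundamental_chamber"
  shows "\<exists>g\<in>P2. g z \<in> fundamental_chamber \<and> norm (w - g z) \<le> norm (w - z)"
proof -
  obtain g where g: "g \<in> P2" and gmax: "\<And>k. k \<in> P2 \<Longrightarrow> w \<bullet> k z \<le> w \<bullet> g z"
    using ex_is_arg_min_if_finite[OF finite_P2, of "\<lambda>k. - (w \<bullet> k z)"] P2_id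
    by (auto simp: is_arg_min_linorder)
  have "w \<bullet> k (g z) \<le> w \<bullet> g z" if "k \<in> P2" for k
    using gmax[OF P2_comp[OF that g]] by simp
  then obtain h where h: "h \<in> P2" "h w = w" "h (g z) \<in> fundamental_chamber"
    using stabiliser_to_chamber[OF w, of "g z"] by (auto simp: P2_stabiliser_def)
  have "w \<bullet> h (g z) = w \<bullet> g z" using P2_inner[OF h(1), of w "g z"] h(2) by simp
  then have "w \<bullet> z \<le> w \<bullet> (h \<circ> g) z" using gmax[OF P2_id] by simp
  then have "norm (w - (h \<circ> g) z) \<le> norm (w - z)"
    by (simp only: norm_diff_P2_le_iff[OF P2_comp[OF h(1) g]])
  then show ?thesis using h(3) P2_comp[OF h(1) g] by (intro bexI[of _ "h \<circ> g"]) auto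
qed

section \<open>The nonincreasing rearrangement as the chamber point of an orbit\<close>

lemma abs_decreasing_P2:
  assumes "g \<in> P2"
  shows "abs_decreasing (g x) = abs_decreasing x"
  using assms
proof (rule P2_cases)
  fix e p
  assume g: "g = signed_perm e p" "\<forall>i. e i \<in> {1, -1}" "p permutes UNIV"
  have "\<bar>g x $ j\<bar> = \<bar>x $ p j\<bar>" for j
    using g(2)[rule_format, of j] by (auto simp: g(1))
  then have "image_mset (\<lambda>j. \<bar>g x $ j\<bar>) (mset_set UNIV)
      = image_mset (\<lambda>j. \<bar>x $ j\<bar>) (image_mset p (mset_set UNIV))"
    by (simp add: multiset.map_comp o_def)
  also have "image_mset p (mset_set UNIV) = mset_set UNIV"
    using g(3) permutes_image[OF g(3)] by (simp add: image_mset_mset_set permutes_inj)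
  finally show ?thesis by (simp add: abs_decreasing_def)
qed

text \<open>In a strictly increasing list the position, counted from 0, is the number of smaller
  members. This decodes the index used in \<open>abs_decreasing\<close>.\<close>

lemma sorted_list_of_set_nth_card:
  fixes A :: "'a::linorder set"
  assumes "finite A" "a \<in> A"
  shows "sorted_list_of_set A ! card {b \<in> A. b < a} = a"
proof -
  let ?l = "sorted_list_of_set A"
  obtain k where k: "k < length ?l" "?l ! k = a"
    using assms by (metis in_set_conv_nth set_sorted_list_of_set)
  have less: "?l ! m < ?l ! k \<longleftrightarrow> m < k" if "m < length ?l" for m
    using that k(1) strict_sorted_list_of_set[of A]
    by (metis linorder_less_linear order_less_asym sorted_wrt_nth_less)
  have "{b \<in> A. b < a} = (!) ?l ` {..<k}"
  proof
    show "{b \<in> A. b < a} \<subseteq> (!) ?l ` {..<k}"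
    proof clarify
      fix b
      assume "b \<in> A" "b < a"
      then obtain m where "m < length ?l" "b = ?l ! m"
        using assms(1) by (metis in_set_conv_nth set_sorted_list_of_set)
      then show "b \<in> (!) ?l ` {..<k}" using less k(2) \<open>b < a\<close> by auto
    qed
    show "(!) ?l ` {..<k} \<subseteq> {b \<in> A. b < a}"
      using less k assms(1) nth_mem[of _ ?l] by force
  qed
  moreover have "inj_on ((!) ?l) {..<k}"
    using k(1) by (intro inj_on_nth) auto
  ultimately show ?thesis using k(2) by (simp add: card_image)
qed

lemma abs_decreasing_chamber:
  fixes z :: "real^'n::{finite,linorder}"
  assumes "z \<in> fundamental_chamber"
  shows "abs_decreasing z = z"
proof -
  let ?l = "sorted_list_of_set (UNIV :: 'n set)"
  \<comment> \<open>Listed by increasing index, the entries of a chamber point already descend, so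
    their reversal is the sorted list of absolute values.\<close>
  have "sorted_wrt (\<lambda>i j. z $ j \<le> z $ i) ?l"
    by (rule sorted_wrt_mono_rel[OF _ sorted_sorted_list_of_set])
      (use assms in \<open>simp add: fundamental_chamber_def\<close>)
  then have "sorted (rev (map (($) z) ?l))"
    by (simp add: sorted_wrt_rev sorted_wrt_map)
  moreover have "mset (rev (map (($) z) ?l)) = image_mset (\<lambda>j. \<bar>z $ j\<bar>) (mset_set UNIV)"
  proof -
    have "\<bar>z $ j\<bar> = z $ j" for j using assms by (simp add: fundamental_chamber_def)
    moreover have "mset ?l = mset_set UNIV"
      by (metis finite mset_sorted_list_of_multiset sorted_list_of_mset_set)
    ultimately show ?thesis by simp
  qed
  ultimately have sl: "sorted_list_of_multiset (image_mset (\<lambda>j. \<bar>z $ j\<bar>) (mset_set UNIV))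
      = rev (map (($) z) ?l)"
    by (metis sorted_list_of_multiset_mset sorted_sort_id)
  show ?thesis
  proof (rule vec_eq_iff[THEN iffD2], rule allI)
    fix i :: 'n
    have "card {j. j < i} < length ?l"
      using psubset_card_mono[of "UNIV :: 'n set" "{j. j < i}"] by auto
    then show "abs_decreasing z $ i = z $ i"
      using sorted_list_of_set_nth_card[of UNIV i] by (simp add: abs_decreasing_def sl)
  qed
qed

text \<open>\<open>abs_decreasing\<close> is constant on orbits and the identity on the chamber, so
  any chamber point in the orbit of \<open>x\<close> is \<open>abs_decreasing x\<close>.\<close>

lemma abs_decreasing_P2_orbit:
  fixes x :: "real^'n::{finite,linorder}"
  obtains g where "g \<in> P2" "g x = abs_decreasing x" "abs_decreasing x \<in> fundamental_chamber"
proof -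
  \<comment> \<open>Zero merely provides a chamber point as centre; the distance estimate is
    discarded.\<close>
  have "(0 :: (real, 'n) vec) \<in> fundamental_chamber" by (simp add: fundamental_chamber_def)
  then obtain g where "g \<in> P2" "g x \<in> fundamental_chamber"
    using P2_to_chamber_closer by blast
  then show ?thesis
    using that abs_decreasing_P2[of g x] abs_decreasing_chamber[of "g x"] by simp
qed

section \<open>Projection onto invariant sets\<close>

lemma mem_projection_iff:
  "y \<in> projection S x \<longleftrightarrow> y \<in> S \<and> (\<forall>z\<in>S. norm (x - y) \<le> norm (x - z))"
  by (auto simp: projection_def is_arg_min_linorder)

lemma projection_invariant_set:
  fixes x :: "real^'n::{finite,linorder}"
  assumes inv_S: "\<And>g y. g \<in> P2 \<Longrightarrow> y \<in> S \<Longrightarrow> g y \<in> S"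
    and Q: "Q \<in> P2" and chamber: "Q x \<in> fundamental_chamber"
  shows "projection S x = {inv Q (h t) |h t.
    h \<in> P2_stabiliser (Q x) \<and> t \<in> projection (fundamental_chamber \<inter> S) (Q x)}" (is "_ = ?R")
proof
  have invQ: "inv Q (Q y) = y" "Q (inv Q y) = y" for y
    using P2_bij[OF Q] by (simp_all add: bij_is_inj bij_is_surj surj_f_inv_f)
  show "projection S x \<subseteq> ?R"
  proof
    fix y
    assume y: "y \<in> projection S x"
    \<comment> \<open>\<open>Q\<close> is an isometry preserving \<open>S\<close>, so it carries the
      nearest point to a nearest point of \<open>Q x\<close>.\<close>
    have min: "norm (Q x - Q y) \<le> norm (Q x - z)" if "z \<in> S" for z
      using y inv_S[OF P2_inv[OF Q] that] P2_norm_diff[OF Q, of x y]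
        P2_norm_diff[OF Q, of x "inv Q z"] by (auto simp: mem_projection_iff invQ)
    have "Q x \<bullet> k (Q y) \<le> Q x \<bullet> Q y" if k: "k \<in> P2" for k
    proof (rule ccontr)
      assume "\<not> ?thesis"
      moreover have "inv k (k (Q y)) = Q y"
        using P2_bij[OF k] by (simp add: bij_is_inj)
      \<comment> \<open>The equivalence is applied to \<open>inv k\<close> at
        \<open>k (Q y)\<close>, so that its negation gives a strict inequality.\<close>
      ultimately have "norm (Q x - k (Q y)) < norm (Q x - Q y)"
        using norm_diff_P2_le_iff[OF P2_inv[OF k], of "Q x" "k (Q y)"] by simp
      moreover have "k (Q y) \<in> S" using y k Q inv_S by (simp add: mem_projection_iff)
      ultimately show False using min by fastforce
    qed
    then obtain h where h: "h \<in> P2" "h (Q x) = Q x" "h (Q y) \<in> fundamental_chamber"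
      using stabiliser_to_chamber[OF chamber, of "Q y"] by (auto simp: P2_stabiliser_def)
    have inv_h: "inv h (h v) = v" for v
      using P2_bij[OF h(1)] by (simp add: bij_is_inj)
    have "norm (Q x - h (Q y)) = norm (Q x - Q y)"
      using P2_norm_diff[OF h(1), of "Q x" "Q y"] h(2) by simp
    then have "h (Q y) \<in> projection (fundamental_chamber \<inter> S) (Q x)"
      using min y h Q inv_S by (simp add: mem_projection_iff)
    moreover have "inv h \<in> P2_stabiliser (Q x)"
      using P2_inv[OF h(1)] inv_h[of "Q x"] h(2) by (simp add: P2_stabiliser_def)
    moreover have "y = inv Q (inv h (h (Q y)))" by (simp add: inv_h invQ)
    ultimately show "y \<in> ?R" by blast
  qed
  show "?R \<subseteq> projection S x"
  proof clarify
    fix h t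
    assume "h \<in> P2_stabiliser (Q x)" and t: "t \<in> projection (fundamental_chamber \<inter> S) (Q x)"
    then have h: "h \<in> P2" "h (Q x) = Q x" by (auto simp: P2_stabiliser_def)
    have "norm (x - inv Q (h t)) \<le> norm (x - z)" if z: "z \<in> S" for z
    proof -
      \<comment> \<open>\<open>t\<close> competes only within the chamber, so \<open>Q z\<close> is
        replaced by a chamber point of its orbit that is no farther from \<open>Q x\<close>.\<close>
      obtain g where g: "g \<in> P2" "g (Q z) \<in> fundamental_chamber"
        "norm (Q x - g (Q z)) \<le> norm (Q x - Q z)"
        using P2_to_chamber_closer[OF chamber] by blast
      have "norm (x - inv Q (h t)) = norm (h (Q x) - h t)"
        using P2_norm_diff[OF Q, of x "inv Q (h t)"] h(2) by (simp add: invQ)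
      also have "\<dots> = norm (Q x - t)" by (rule P2_norm_diff[OF h(1)])
      also have "\<dots> \<le> norm (Q x - g (Q z))"
        using t g z Q inv_S by (simp add: mem_projection_iff)
      also have "\<dots> \<le> norm (x - z)" using g(3) P2_norm_diff[OF Q, of x z] by simp
      finally show ?thesis .
    qed
    moreover have "inv Q (h t) \<in> S"
      using t h(1) P2_inv[OF Q] inv_S by (simp add: mem_projection_iff)
    ultimately show "inv Q (h t) \<in> projection S x" by (simp add: mem_projection_iff)
  qed
qed

text \<open>The first conjunct ensures that the quantification over \<open>Q\<close> is not vacuous;
  the formula then holds for every such \<open>Q\<close>.\<close>

theorem lemma11:
  fixes s :: nat
    and x :: "real^'n::{finite,linorder}"
    and B :: "(real^'n::{finite,linorder}) set"
  assumes "B \<noteq> {}" and "closed B" and "convex B" and "P2_invariant B"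
  shows "(\<exists>Q\<in>P2. Q x = abs_decreasing x) \<and>
    (\<forall>Q\<in>P2. Q x = abs_decreasing x \<longrightarrow>
      projection (sparse_vectors s \<inter> B) x =
        {inv_into UNIV Q (h t) |h t.
           h \<in> P2_stabiliser (Q x) \<and>
           t \<in> projection (fundamental_chamber \<inter> sparse_vectors s \<inter> B) (Q x)})"
proof -
  obtain g where g: "g \<in> P2" "g x = abs_decreasing x" "abs_decreasing x \<in> fundamental_chamber"
    by (rule abs_decreasing_P2_orbit)
  \<comment> \<open>Signed permutations preserve the size of the support, so the intersection
    inherits invariance from both sets.\<close>
  have "k y \<in> sparse_vectors s \<inter> B" if "k \<in> P2" "y \<in> sparse_vectors s \<inter> B" for k y
    using that P2_sparse assms(4) by (fastforce simp: P2_invariant_def)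
  then have "projection (sparse_vectors s \<inter> B) x = {inv Q (h t) |h t. h \<in> P2_stabiliser (Q x) \<and>
      t \<in> projection (fundamental_chamber \<inter> sparse_vectors s \<inter> B) (Q x)}"
    if "Q \<in> P2" "Q x = abs_decreasing x" for Q
    using projection_invariant_set[of "sparse_vectors s \<inter> B" Q x] that g(3) by (simp add: Int_assoc)
  then show ?thesis using g(1,2) by blast
qed

end
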